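(* Let $q=p^s$, $m$, $\omega$, $K$, $D_0$, $D_1$, $\epsilon$ be as in the context, let $T_0,T_1\subseteq\mathbb{F}_q$, and let $$S_0=\{x\in\mathbb{F}_{q^2}\mid \mathrm{Tr}_{q^2/q}(x)\in T_0\},\quad S_1=\{x\in\mathbb{F}_{q^2}\mid \mathrm{Tr}_{q^2/q}(x\omega^m)\in T_1\},\quad A_0=S_0\setminus S_1,\quad A_1=S_1\setminus S_0.$$ (1) If $|T_0|=|T_1|=(q-1)/2$, then $$E_0=\{(x,xy)\mid x\in D_0,y\in A_0\}\cup\{(x,xy)\mid x\in D_1,y\in A_1\}\cup\{(0,x)\mid x\in D_\epsilon\}$$ is a set of type Q in $\mathbb{F}_{q^2}\times\mathbb{F}_{q^2}$. (2) If $|T_0|=(q-1)/2$ and $|T_1|=(q+1)/2$, then $$E_1=\{(x,xy)\mid x\in D_0,y\in A_0\}\cup\{(x,xy)\mid x\in D_1,y\in A_1\}$$ is a set of type Q in $\mathbb{F}_{q^2}\times\mathbb{F}_{q^2}$.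
   Context: Let $q=p^s$ be an odd prime power with $p$ prime, and let $m$ be a positive integer with $2m\mid(q+1)$. Let $\ell$ be the least positive integer with $2m\mid(p^\ell+1)$ and write $s=\ell t$ with $t\ge1$. Put $\epsilon=1$ if $(p^\ell+1)/(2m)$ is even and $t$ is odd, and $\epsilon=0$ otherwise. Let $\omega$ be a primitive element of $\mathbb{F}_{q^2}$, and $C_i^{(2m,q^2)}=\omega^i\langle\omega^{2m}\rangle$ (index taken modulo $2m$). Let $K$ be any $m$-subset of $\{0,1,\ldots,2m-1\}$ with $K\cap\{x+m\ (\mathrm{mod}\ 2m)\mid x\in K\}=\emptyset$, and put $D_0=\bigcup_{i\in K}C_i^{(2m,q^2)}$, $D_1=\bigcup_{i\in K}C_{i+m}^{(2m,q^2)}$. $\mathrm{Tr}_{q^2/q}(x)=x+x^q$. Let $\psi_{\mathbb{F}_{q^2}}(x)=\zeta_p^{\mathrm{Tr}_{q^2/p}(x)}$ be the canonical additive character of $\mathbb{F}_{q^2}$ ($\zeta_p$ a fixed primitive complex $p$-th root of unity, $\mathrm{Tr}_{q^2/p}$ the absolute trace). For $(a,b)\in\mathbb{F}_{q^2}\times\mathbb{F}_{q^2}$ and $E\subseteq\mathbb{F}_{q^2}\times\mathbb{F}_{q^2}$ put $\psi_{a,b}(E)=\sum_{(x,y)\in E}\psi_{\mathbb{F}_{q^2}}(ax+by)$. A set $E\subseteq(\mathbb{F}_{q^2}\times\mathbb{F}_{q^2})\setminus\{(0,0)\}$ that is closed under multiplication by $\mathbb{F}_q^*$ is called of type Q if $|E|=\frac{q^4-1}{4}$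 and the values $\psi_{a,b}(E)$, over all $(a,b)\neq(0,0)$, are exactly the two values $\frac{q^2-1}{4}$ and $\frac{-3q^2-1}{4}$. (Equivalently, the corresponding point set of $\mathrm{PG}(3,q)$ has $\frac{q^4-1}{4(q-1)}$ points and every plane meets it in $\frac{(q-1)^2}{4}$ or $\frac{(q+1)^2}{4}$ points.) *)

theory Defs
  imports Complex_Main "HOL-Library.Cardinality" "HOL-Computational_Algebra.Primes"
begin

text \<open>
  A finite field of order \<open>q\<^sup>2\<close> is a type of class \<open>finite_field\<close> with
  \<open>q\<^sup>2\<close> elements; its subfield of order \<open>q\<close> is the following set.
\<close>

definition subfield_of_order :: "nat \<Rightarrow> 'a::finite_field set" where
  "subfield_of_order q = {x. x ^ q = x}"

definition primitive_elem :: "'a::finite_field \<Rightarrow> bool" where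
  "primitive_elem \<omega> \<longleftrightarrow> range (\<lambda>k::nat. \<omega> ^ k) = UNIV - {0}"

text \<open>
  The coset \<open>\<omega>\<^sup>i \<langle>\<omega>\<^sup>N\<rangle>\<close>. As \<open>\<omega>\<close> has finite order,
  nonnegative exponents suffice, and the coset depends on \<open>i\<close> only modulo \<open>N\<close>.
\<close>

definition cyclotomic_class :: "'a::finite_field \<Rightarrow> nat \<Rightarrow> nat \<Rightarrow> 'a set" where
  "cyclotomic_class \<omega> N i = {\<omega> ^ i * (\<omega> ^ N) ^ j | j :: nat. True}"

text \<open>The trace from the field of order \<open>r\<^sup>n\<close> to its subfield of order \<open>r\<close>.\<close>

definition field_trace :: "nat \<Rightarrow> nat \<Rightarrow> 'a::finite_field \<Rightarrow> 'a" where
  "field_trace r n x = (\<Sum>i<n. x ^ (r ^ i))"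

definition primitive_root_unity :: "nat \<Rightarrow> complex \<Rightarrow> bool" where
  "primitive_root_unity n \<zeta> \<longleftrightarrow> \<zeta> ^ n = 1 \<and> (\<forall>k. 0 < k \<and> k < n \<longrightarrow> \<zeta> ^ k \<noteq> 1)"

text \<open>
  The canonical additive character of the field of order \<open>p\<^sup>n\<close>. The absolute trace lies in
  the prime subfield, so it is \<open>of_nat k\<close> for a unique \<open>k < p\<close>; this \<open>k\<close> is
  the exponent of \<open>\<zeta>\<close>.
\<close>

definition canonical_char :: "complex \<Rightarrow> nat \<Rightarrow> nat \<Rightarrow> 'a::finite_field \<Rightarrow> complex" where
  "canonical_char \<zeta> p n x = \<zeta> ^ (THE k. k < p \<and> of_nat k = field_trace p n x)"

definition char_sum :: "('a::finite_field \<Rightarrow> complex) \<Rightarrow> 'a \<Rightarrow> 'a \<Rightarrow> ('a \<times> 'a) set \<Rightarrow> complex" where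
  "char_sum \<psi> a b E = (\<Sum>(x, y)\<in>E. \<psi> (a * x + b * y))"

definition type_Q :: "('a::finite_field \<Rightarrow> complex) \<Rightarrow> nat \<Rightarrow> ('a \<times> 'a) set \<Rightarrow> bool" where
  "type_Q \<psi> q E \<longleftrightarrow>
     (0, 0) \<notin> E \<and>
     (\<forall>c \<in> subfield_of_order q - {0}. \<forall>(x, y) \<in> E. (c * x, c * y) \<in> E) \<and>
     real (card E) = (real q ^ 4 - 1) / 4 \<and>
     {char_sum \<psi> a b E | a b. (a, b) \<noteq> (0, 0)} =
       {(of_nat q ^ 2 - 1) / 4, (- 3 * of_nat q ^ 2 - 1) / 4}"

end

theory Submission
  imports Defs "HOL-Number_Theory.Cong" "HOL-Computational_Algebra.Polynomial"
begin

text \<open>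
  Write \<open>L\<close> for the field of order \<open>q\<^sup>2\<close> and \<open>F\<close> for its subfield of order \<open>q\<close>. As
  \<open>2 * m\<close> divides \<open>q + 1\<close>, the sets \<open>D0\<close> and \<open>D1\<close> are unions of punctured \<open>F\<close>-lines,
  so no Gauss sums are needed: a line \<open>F x\<close> contributes \<open>q - 1\<close> or \<open>- 1\<close> to a character
  sum according to whether its trace vanishes, and the trace vanishes on exactly one line.
  Multiplication by \<open>\<omega> ^ m\<close> exchanges \<open>D0\<close> and \<open>D1\<close>.

  For \<open>b \<noteq> 0\<close> expand the indicators of \<open>A0\<close> and \<open>A1\<close> as those of \<open>S0\<close> and \<open>S1\<close> minus that
  of \<open>S0 \<inter> S1\<close>. The common part gives a sum over all nonzero \<open>x\<close>. For \<open>S0\<close> the sum over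
  \<open>y\<close> vanishes unless \<open>b x \<in> F\<close>, because \<open>S0\<close> is invariant under the kernel of the trace;
  likewise for \<open>S1\<close> with \<open>b x \<in> \<omega> ^ m F\<close>. With \<open>\<alpha>\<close>, \<open>\<beta>\<close>, \<open>\<delta>\<close> the truth values (0 or 1)
  of \<open>- a / b \<in> S0\<close>, \<open>- a / b \<in> S1\<close>, \<open>1 / b \<in> D0\<close>, the character sum turns out to be
  \<open>(q\<^sup>2 - 1) / 4 + q\<^sup>2 (\<delta> (\<alpha> + \<beta> - 1) - \<alpha> \<beta>)\<close> in both cases, and the bracket is \<open>0\<close> or \<open>- 1\<close>.
\<close>

section \<open>Preliminaries on finite fields, finite sums and residues\<close>

text \<open>Translation by 1 permutes the field, so the sum of all elements is unchanged when
  \<open>CARD('a)\<close> ones are added to it.\<close>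

lemma CHAR_dvd_card: "CHAR('a::finite_field) dvd CARD('a)"
proof -
  have "(\<Sum>x\<in>UNIV. x + 1 :: 'a) = (\<Sum>x\<in>UNIV. x)"
    by (rule sum.reindex_bij_witness[of _ "\<lambda>x. x - 1" "\<lambda>x. x + 1"]) auto
  then have "of_nat (CARD('a)) = (0 :: 'a)"
    by (simp add: sum.distrib)
  then show ?thesis
    by (simp only: of_nat_eq_0_iff_char_dvd)
qed

text \<open>Translation by \<open>z\<close> permutes \<open>A\<close> but multiplies the sum by
  \<open>f z\<close>. Working on a subgroup \<open>A\<close> covers both the small field and the
  whole field.\<close>

lemma sum_nontrivial_char_eq_0:
  fixes f :: "'a::ab_group_add \<Rightarrow> complex"
  assumes "\<And>x y. x \<in> A \<Longrightarrow> y \<in> A \<Longrightarrow> f (x + y) = f x * f y"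
    and "\<And>x y. x \<in> A \<Longrightarrow> y \<in> A \<Longrightarrow> x + y \<in> A" "\<And>x y. x \<in> A \<Longrightarrow> y \<in> A \<Longrightarrow> x - y \<in> A"
    and "z \<in> A" "f z \<noteq> 1"
  shows "(\<Sum>x\<in>A. f x) = 0"
proof -
  have "(\<Sum>x\<in>A. f x) = (\<Sum>x\<in>A. f (x + z))"
    by (rule sum.reindex_bij_witness[of _ "\<lambda>x. x + z" "\<lambda>x. x - z"]) (use assms in auto)
  also have "\<dots> = (\<Sum>x\<in>A. f x) * f z"
    using assms by (simp add: sum_distrib_right)
  finally show ?thesis
    using assms(5) by (simp add: field_simps)
qed

lemma card_power_fixed_le:
  assumes r: "r > 1"
  shows "card {x::'a::idom. x ^ r = x} \<le> r"
proof -
  define P where "P = (monom 1 r - monom 1 1 :: 'a poly)"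
  have "coeff P r = 1"
    using r by (simp add: P_def)
  then have "P \<noteq> 0" by auto
  moreover have "degree P \<le> r"
    unfolding P_def by (rule degree_diff_le) (use r in \<open>auto simp: degree_monom_eq\<close>)
  moreover have "{x. poly P x = 0} = {x. x ^ r = x}"
    by (auto simp: P_def poly_monom)
  ultimately show ?thesis
    using card_poly_roots_bound[of P] by simp
qed

lemma field_trace_mult:
  assumes "c ^ r = c"
  shows "field_trace r n (c * x) = c * field_trace r n x"
proof -
  have "c ^ (r ^ i) = c" for i
    by (induction i) (simp_all add: power_mult assms)
  then show ?thesis
    by (simp add: field_trace_def power_mult_distrib sum_distrib_left)
qed

lemma sum_scaled_pairs:
  fixes f :: "'c::field \<times> 'c \<Rightarrow> 'b::comm_monoid_add"
  assumes "0 \<notin> D"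
  shows "sum f {(x, x * y) | x y. x \<in> D \<and> y \<in> A} = (\<Sum>x\<in>D. \<Sum>y\<in>A. f (x, x * y))"
proof -
  have "sum f {(x, x * y) | x y. x \<in> D \<and> y \<in> A} = (\<Sum>(x, y)\<in>D \<times> A. f (x, x * y))"
    by (rule sum.reindex_bij_witness[of _ "\<lambda>(x, y). (x, x * y)" "\<lambda>(x, y). (x, y / x)"])
      (use assms in auto)
  then show ?thesis
    by (simp add: sum.cartesian_product)
qed

text \<open>The shift by \<open>m\<close> is an involution on the residues. \<open>K\<close> and its
  image are disjoint of size \<open>m\<close> each, so together they exhaust all
  \<open>2 * m\<close> residues, and \<open>K\<close> picks exactly one from each pair of swapped
  residues.\<close>

lemma half_residue_system_shift:
  fixes m :: nat
  assumes K: "K \<subseteq> {0..<2 * m}" "card K = m" "K \<inter> {(x + m) mod (2 * m) | x. x \<in> K} = {}"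
    and "r < 2 * m"
  shows "(r + m) mod (2 * m) \<in> K \<longleftrightarrow> r \<notin> K"
proof -
  define \<sigma> where "\<sigma> = (\<lambda>x. (x + m) mod (2 * m))"
  have invol: "\<sigma> (\<sigma> x) = x" if "x < 2 * m" for x
  proof -
    have "\<sigma> (\<sigma> x) = (x + 2 * m) mod (2 * m)"
      unfolding \<sigma>_def by (simp add: mod_simps add.assoc mult_2)
    then show ?thesis
      using that by simp
  qed
  have disj: "K \<inter> \<sigma> ` K = {}"
    using K(3) by (auto simp: \<sigma>_def)
  have "inj_on \<sigma> K"
    using invol K(1) by (intro inj_on_inverseI[of _ \<sigma>]) auto
  moreover have fin: "finite K"
    using K(1) finite_subset by blast
  ultimately have "card (K \<union> \<sigma> ` K) = 2 * m"
    using disj K(2) by (simp add: card_Un_disjoint card_image)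
  moreover have "\<sigma> ` K \<subseteq> {0..<2 * m}"
    using \<open>r < 2 * m\<close> by (auto simp: \<sigma>_def)
  ultimately have "K \<union> \<sigma> ` K = {0..<2 * m}"
    using K(1) by (intro card_subset_eq) auto
  then have "r \<in> K \<union> \<sigma> ` K"
    using \<open>r < 2 * m\<close> by simp
  moreover have "\<sigma> (\<sigma> k) \<in> K" if "k \<in> K" for k
    using invol[of k] K(1) that by auto
  ultimately have "\<sigma> r \<in> K \<longleftrightarrow> r \<notin> K"
    using disj by blast
  then show ?thesis
    by (simp add: \<sigma>_def)
qed

text \<open>The cofactor is the alternating sum of \<open>2 * j + 1\<close> powers of
  \<open>x\<close>, all odd; the induction adds two terms at a time. The alternating signs are the
  reason for working over the integers.\<close>

lemma odd_power_plus_1_factor: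
  fixes x :: int
  assumes "odd x"
  shows "\<exists>r. odd r \<and> x ^ (2 * j + 1) + 1 = (x + 1) * r"
proof (induction j)
  case 0
  then show ?case by (intro exI[of _ 1]) simp
next
  case (Suc j)
  then obtain r where r: "odd r" "x ^ (2 * j + 1) + 1 = (x + 1) * r"
    by blast
  have "x ^ (2 * Suc j + 1) + 1 = x\<^sup>2 * (x ^ (2 * j + 1) + 1) - (x\<^sup>2 - 1)"
    by (simp add: algebra_simps power2_eq_square)
  also have "\<dots> = (x + 1) * (x\<^sup>2 * r - (x - 1))"
    unfolding r(2) by (simp add: algebra_simps power2_eq_square)
  finally show ?case
    using assms r(1) by (intro exI[of _ "x\<^sup>2 * r - (x - 1)"]) simp
qed

text \<open>With \<open>x = p ^ l\<close> this turns the definition of \<open>\<epsilon>\<close>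
  into the parity of \<open>(q + 1) div (2 * m)\<close>, which decides how \<open>anti\<close> acts
  on \<open>D0\<close>. For odd \<open>t\<close> the two quotients differ by an odd factor.\<close>

lemma even_power_plus_1_div:
  fixes x m t :: nat
  assumes x: "odd x" "2 * m dvd x + 1" and m: "m \<ge> 1" and t: "t \<ge> 1" "2 * m dvd x ^ t + 1"
  shows "even ((x ^ t + 1) div (2 * m)) \<longleftrightarrow> even ((x + 1) div (2 * m)) \<and> odd t"
proof -
  obtain u where u: "x + 1 = 2 * m * u"
    using x(2) by blast
  obtain v where v: "x ^ t + 1 = 2 * m * v"
    using t(2) by blast
  have "even v \<longleftrightarrow> even u \<and> odd t"
  proof (cases "odd t")
    case True
    then obtain j where j: "t = 2 * j + 1"
      by (elim oddE)
    obtain r where r: "odd r" "int x ^ t + 1 = (int x + 1) * r"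
      using odd_power_plus_1_factor[of "int x" j] x(1) j by auto
    have "int (2 * m) * int v = (int x + 1) * r"
      using r(2) arg_cong[OF v, of int] by simp
    also have "int x + 1 = int (2 * m) * int u"
      using arg_cong[OF u, of int] by simp
    finally have "int (2 * m) * int v = int (2 * m) * (int u * r)"
      by (simp only: mult.assoc)
    then have "int v = int u * r"
      using m by simp
    then have "even (int v) \<longleftrightarrow> even (int u)"
      using r(1) by simp
    then show ?thesis
      using True by simp
  next
    \<comment> \<open>Here \<open>x ^ t\<close> is congruent to both \<open>1\<close> and \<open>- 1\<close> modulo \<open>2 * m\<close>, which forces \<open>m = 1\<close>.\<close>
    case False
    then obtain j where j: "t = 2 * j"
      by (auto elim!: evenE)
    \<comment> \<open>As the square of an odd number, \<open>x ^ t\<close> is 1 modulo 4, so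
      \<open>x ^ t + 1\<close> is twice an odd number; once \<open>m = 1\<close> is known, that
      number is \<open>v\<close>.\<close>
    have "odd (x ^ j)"
      using x(1) by simp
    then have "(x ^ j) mod 4 = 1 \<or> (x ^ j) mod 4 = 3"
      by presburger
    then have "((x ^ j mod 4) * (x ^ j mod 4)) mod 4 = 1"
      by (elim disjE) simp_all
    then have "(x ^ j * x ^ j) mod 4 = 1"
      by (simp only: mod_mult_eq)
    then have mod4: "x ^ t mod 4 = 1"
      by (simp add: j mult_2 power_add)
    have "int (2 * m) dvd int (x + 1)"
      using x(2) by (simp only: int_dvd_int_iff)
    then have "int x mod int (2 * m) = (- 1) mod int (2 * m)"
      unfolding mod_eq_dvd_iff by (simp add: add.commute)
    then have "int x ^ t mod int (2 * m) = (- 1) ^ t mod int (2 * m)"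
      by (metis power_mod)
    then have "int (2 * m) dvd int x ^ t - 1"
      using False by (simp add: mod_eq_dvd_iff)
    moreover have "int (2 * m) dvd int (x ^ t + 1)"
      using t(2) by (simp only: int_dvd_int_iff)
    then have "int (2 * m) dvd int x ^ t + 1"
      by (simp add: add.commute)
    ultimately have "int (2 * m) dvd (int x ^ t + 1) - (int x ^ t - 1)"
      by (rule dvd_diff[rotated])
    then have "int (2 * m) dvd int 2"
      by simp
    then have "2 * m dvd 2"
      by (simp only: int_dvd_int_iff)
    then have "m = 1"
      using m by (auto dest: dvd_imp_le)
    then have "odd v"
      using mod4 v by presburger
    then show ?thesis
      using False by simp
  qed
  then show ?thesis
    unfolding u v using m by simp
qed

subsection \<open>Additive characters\<close>

locale prime_power_field =
  fixes p :: nat and ty :: "'a::finite_field itself" and \<zeta> :: complex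
  assumes CHAR_eq: "CHAR('a) = p"
    and root: "primitive_root_unity p \<zeta>"
begin

lemma prime_p: "prime p"
  using CHAR_eq CHAR_prime[where ?'a = 'a] by simp

lemma p_pos [simp]: "p > 0"
  using prime_p prime_gt_0_nat by blast

lemma frobenius_add: "(x + y :: 'a) ^ (p ^ i) = x ^ (p ^ i) + y ^ (p ^ i)"
  by (rule freshmans_dream') (simp_all add: CHAR_eq prime_p)

lemma frobenius_diff: "(x - y :: 'a) ^ (p ^ i) = x ^ (p ^ i) - y ^ (p ^ i)"
  using frobenius_add[of "x - y" y i] by (simp add: algebra_simps)

lemma frobenius_sum: "sum f A ^ (p ^ i) = (\<Sum>x\<in>A. f x ^ (p ^ i) :: 'a)"
  by (rule freshmans_dream_sum') (simp_all add: CHAR_eq prime_p)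

lemma field_trace_add: "field_trace (p ^ j) n (x + y :: 'a) = field_trace (p ^ j) n x + field_trace (p ^ j) n y"
  by (simp add: field_trace_def frobenius_add sum.distrib flip: power_mult)

text \<open>The \<open>r\<close>-th power moves each summand to the next one, and the last summand
  wraps around to \<open>x\<close>.\<close>

lemma field_trace_fixed:
  assumes "(x::'a) ^ (r ^ n) = x" "r = p ^ j"
  shows "field_trace r n x ^ r = field_trace r n x"
proof -
  have "field_trace r n x ^ r = (\<Sum>i<n. x ^ (r ^ Suc i))"
    unfolding field_trace_def assms(2) frobenius_sum by (simp add: mult.commute flip: power_mult)
  also have "\<dots> = (\<Sum>i<Suc n. x ^ (r ^ i)) - x"
    by (simp only: sum.lessThan_Suc_shift) simp
  finally show ?thesis
    by (simp add: field_trace_def assms(1))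
qed

text \<open>The \<open>p\<close> multiples of 1 are distinct and fixed by the \<open>p\<close>-th
  power, while \<open>X ^ p - X\<close> has at most \<open>p\<close> roots. This makes the definite
  description in \<open>canonical_char\<close> meaningful.\<close>

lemma prime_subfield:
  assumes "(x::'a) ^ p = x"
  shows "\<exists>!k. k < p \<and> of_nat k = x"
proof -
  have inj: "inj_on (of_nat :: nat \<Rightarrow> 'a) {..<p}"
    by (intro inj_onI) (auto simp: of_nat_eq_iff_cong_CHAR CHAR_eq cong_def)
  have "(of_nat k :: 'a) ^ p = of_nat k" for k
    by (induction k) (use frobenius_add[of _ _ 1] in \<open>simp_all\<close>)
  then have sub: "of_nat ` {..<p} \<subseteq> {x::'a. x ^ p = x}"
    by auto
  have "of_nat ` {..<p} = {x::'a. x ^ p = x}"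
    by (rule card_seteq) (use sub inj card_power_fixed_le[of p] prime_p prime_gt_1_nat in \<open>auto simp: card_image\<close>)
  then have "x \<in> of_nat ` {..<p}"
    using assms by simp
  then show ?thesis
    using inj by (auto simp: inj_on_def)
qed

lemma root_power_mod: "\<zeta> ^ (k mod p) = \<zeta> ^ k"
proof -
  have "\<zeta> ^ k = \<zeta> ^ (p * (k div p) + k mod p)" by simp
  also have "\<dots> = \<zeta> ^ (k mod p)"
    using root by (simp only: power_add power_mult) (simp add: primitive_root_unity_def)
  finally show ?thesis ..
qed

text \<open>Removes the definite description: since \<open>\<zeta> ^ p = 1\<close>, any natural
  number representing the trace can serve as exponent, reduced or not.\<close>

lemma canonical_char_of_nat:
  assumes "field_trace p n (x::'a) = of_nat k"
  shows "canonical_char \<zeta> p n x = \<zeta> ^ k"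
proof -
  have "(THE k. k < p \<and> of_nat k = field_trace p n x) = k mod p"
    by (rule the_equality) (auto simp: assms of_nat_eq_iff_cong_CHAR CHAR_eq cong_def)
  then show ?thesis
    by (simp add: canonical_char_def root_power_mod)
qed

lemma field_trace_of_nat:
  assumes "(x::'a) ^ (p ^ n) = x"
  obtains k where "k < p" "field_trace p n x = of_nat k"
  using prime_subfield[OF field_trace_fixed[OF assms, of 1]] by fastforce

lemma canonical_char_add:
  assumes "(x::'a) ^ (p ^ n) = x" "y ^ (p ^ n) = y"
  shows "canonical_char \<zeta> p n (x + y) = canonical_char \<zeta> p n x * canonical_char \<zeta> p n y"
proof -
  obtain k where k: "field_trace p n x = of_nat k"
    using field_trace_of_nat[OF assms(1)] by blast
  obtain l where l: "field_trace p n y = of_nat l"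
    using field_trace_of_nat[OF assms(2)] by blast
  have "field_trace p n (x + y) = of_nat (k + l)"
    using field_trace_add[of 1 n x y] k l by simp
  from canonical_char_of_nat[OF this] show ?thesis
    by (simp add: canonical_char_of_nat[OF k] canonical_char_of_nat[OF l] power_add)
qed

lemma canonical_char_eq_1:
  assumes "(x::'a) ^ (p ^ n) = x" "canonical_char \<zeta> p n x = 1"
  shows "field_trace p n x = 0"
proof -
  obtain k where k: "k < p" "field_trace p n x = of_nat k"
    using field_trace_of_nat[OF assms(1)] by blast
  then have "\<zeta> ^ k = 1"
    using assms(2) by (simp add: canonical_char_of_nat)
  then have "k = 0"
    using root k(1) by (auto simp: primitive_root_unity_def)
  then show ?thesis
    using k(2) by simp
qed

lemma canonical_char_0 [simp]: "canonical_char \<zeta> p n (0::'a) = 1"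
  by (rule canonical_char_of_nat[where k = 0, simplified]) (simp add: field_trace_def zero_power)

text \<open>The trace is a polynomial function of degree at most \<open>p ^ (n - 1)\<close>, too
  small to vanish on all of \<open>A\<close>. The polynomial is nonzero because only the summand
  \<open>i = 0\<close> contributes to its linear coefficient.\<close>

lemma exists_field_trace_nonzero:
  assumes "n \<ge> 1" "card A \<ge> p ^ n"
  obtains x :: 'a where "x \<in> A" "field_trace p n x \<noteq> 0"
proof -
  define P where "P = (\<Sum>i<n. monom 1 (p ^ i) :: 'a poly)"
  have p1: "p > 1"
    using prime_p prime_gt_1_nat by blast
  have "coeff P 1 = (\<Sum>i<n. if i = 0 then 1 else 0)"
    unfolding P_def coeff_sum by (rule sum.cong) (use p1 in auto)
  also have "\<dots> = 1"
    using assms(1) by simp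
  finally have "P \<noteq> 0" by auto
  have "degree P \<le> p ^ (n - 1)"
    unfolding P_def
    by (rule degree_sum_le) (use p1 in \<open>auto simp: degree_monom_eq intro!: power_increasing\<close>)
  also have "\<dots> < p ^ n"
    using p1 assms(1) by (intro power_strict_increasing) auto
  finally have deg: "degree P < card A"
    using assms(2) by simp
  have "poly P x = field_trace p n x" for x
    by (simp add: P_def field_trace_def poly_sum poly_monom)
  then have "card {x. field_trace p n x = (0::'a)} \<le> degree P"
    using card_poly_roots_bound[OF \<open>P \<noteq> 0\<close>] by simp
  then have "card {x. field_trace p n x = (0::'a)} < card A"
    using deg by simp
  then have "\<not> A \<subseteq> {x. field_trace p n x = 0}"
    using card_mono[of "{x. field_trace p n x = 0}" A] by (auto simp del: subset_iff)
  then show ?thesis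
    using that by blast
qed

end

subsection \<open>The quadratic extension\<close>

locale quadratic_extension =
  fixes p s q :: nat and \<omega> :: "'a::finite_field" and \<zeta> :: complex
  assumes p: "prime p" and s: "s \<ge> 1" and q: "q = p ^ s" and odd_q: "odd q"
    and card_UNIV: "CARD('a) = q ^ 2"
    and primitive: "primitive_elem \<omega>"
    and zeta: "primitive_root_unity p \<zeta>"

sublocale quadratic_extension \<subseteq> prime_power_field p "TYPE('a)" \<zeta>
proof
  have "CHAR('a) dvd p ^ (s * 2)"
    using CHAR_dvd_card[where ?'a = 'a] card_UNIV q by (simp add: power_mult)
  then have "CHAR('a) dvd p"
    using prime_dvd_power CHAR_prime by blast
  then show "CHAR('a) = p"
    using p primes_dvd_imp_eq CHAR_prime by blast
qed (rule zeta)

context quadratic_extension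
begin

abbreviation base :: "'a set" where "base \<equiv> subfield_of_order q"
abbreviation Tr :: "'a \<Rightarrow> 'a" where "Tr \<equiv> field_trace q 2"
abbreviation \<phi> :: "'a \<Rightarrow> complex" where "\<phi> \<equiv> canonical_char \<zeta> p s"
abbreviation \<psi> :: "'a \<Rightarrow> complex" where "\<psi> \<equiv> canonical_char \<zeta> p (2 * s)"

lemma q_ge_3: "q \<ge> 3"
proof -
  have "q > 1"
    using one_less_power[of p s] p s prime_gt_1_nat[of p] by (simp add: q)
  with odd_q show ?thesis by presburger
qed

lemma q_sq: "q\<^sup>2 = p ^ (2 * s)"
  by (simp add: q mult.commute flip: power_mult)

lemma q_sq_minus_1: "q\<^sup>2 - 1 = (q + 1) * (q - 1)"
  by (simp add: algebra_simps power2_eq_square)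

lemma power_q_sq [simp]: "(x::'a) ^ (q ^ 2) = x"
  using finite_field_power_card_eq_same[of x] by (simp add: card_UNIV)

lemma mem_base: "x \<in> base \<longleftrightarrow> x ^ q = x"
  by (simp add: subfield_of_order_def)

lemma base_0 [simp]: "0 \<in> base" and base_1 [simp]: "1 \<in> base"
  using q_ge_3 by (auto simp: mem_base)

lemma base_add: "x \<in> base \<Longrightarrow> y \<in> base \<Longrightarrow> x + y \<in> base"
  using frobenius_add[of x y s] by (simp add: mem_base flip: q)

lemma base_diff: "x \<in> base \<Longrightarrow> y \<in> base \<Longrightarrow> x - y \<in> base"
  using frobenius_diff[of x y s] by (simp add: mem_base flip: q)

lemma base_mult: "x \<in> base \<Longrightarrow> y \<in> base \<Longrightarrow> x * y \<in> base"
  by (simp add: mem_base power_mult_distrib)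

lemma base_divide: "x \<in> base \<Longrightarrow> y \<in> base \<Longrightarrow> x / y \<in> base"
  by (simp add: mem_base power_divide)

section \<open>Discrete logarithms to base \<open>\<omega>\<close>\<close>

lemma omega_nonzero [simp]: "\<omega> \<noteq> 0"
proof -
  have "\<omega> ^ 1 \<in> UNIV - {0}"
    using primitive unfolding primitive_elem_def by blast
  then show ?thesis by simp
qed

lemma omega_log:
  assumes "x \<noteq> (0::'a)"
  obtains n where "x = \<omega> ^ n"
  using primitive assms unfolding primitive_elem_def by (metis DiffI UNIV_I image_iff singletonD)

lemma omega_power_order: "\<omega> ^ (q\<^sup>2 - 1) = 1"
proof -
  have "Suc (q\<^sup>2 - 1) = q\<^sup>2"
    using q_ge_3 zero_less_power[of q 2] by simp
  then have "\<omega> * \<omega> ^ (q\<^sup>2 - 1) = \<omega>"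
    by (simp only: power_q_sq flip: power_Suc)
  then show ?thesis by simp
qed

lemma omega_power_mod: "\<omega> ^ (n mod (q\<^sup>2 - 1)) = \<omega> ^ n"
proof -
  have "\<omega> ^ n = \<omega> ^ ((q\<^sup>2 - 1) * (n div (q\<^sup>2 - 1)) + n mod (q\<^sup>2 - 1))" by simp
  also have "\<dots> = \<omega> ^ (n mod (q\<^sup>2 - 1))"
    by (simp only: power_add power_mult omega_power_order) simp
  finally show ?thesis ..
qed

text \<open>The powers with exponent below \<open>q\<^sup>2 - 1\<close> already reach all
  \<open>q\<^sup>2 - 1\<close> nonzero elements, so by counting they are distinct.\<close>

lemma omega_power_eq_iff: "\<omega> ^ i = \<omega> ^ j \<longleftrightarrow> [i = j] (mod (q\<^sup>2 - 1))"
proof -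
  have "q\<^sup>2 - 1 > 0"
    unfolding q_sq_minus_1 using q_ge_3 by simp
  then have "\<omega> ^ n \<in> (^) \<omega> ` {..<q\<^sup>2 - 1}" for n
    by (intro image_eqI[of _ _ "n mod (q\<^sup>2 - 1)"]) (simp_all only: omega_power_mod lessThan_iff mod_less_divisor)
  then have "(^) \<omega> ` {..<q\<^sup>2 - 1} = UNIV - {0}"
    using primitive unfolding primitive_elem_def by (metis (no_types) image_subsetI subset_antisym image_mono subset_UNIV)
  then have "inj_on ((^) \<omega>) {..<q\<^sup>2 - 1}"
    by (intro eq_card_imp_inj_on) (simp_all add: card_UNIV card_Diff_singleton)
  then have "\<omega> ^ (i mod (q\<^sup>2 - 1)) = \<omega> ^ (j mod (q\<^sup>2 - 1)) \<longleftrightarrow> i mod (q\<^sup>2 - 1) = j mod (q\<^sup>2 - 1)"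
    using \<open>q\<^sup>2 - 1 > 0\<close> by (intro inj_on_eq_iff) auto
  then show ?thesis
    by (simp only: omega_power_mod cong_def)
qed

text \<open>The condition is that \<open>(q + 1) * (q - 1)\<close> divides
  \<open>n * (q - 1)\<close>. Since \<open>2 * m\<close> divides \<open>q + 1\<close>, a factor from
  \<open>base\<close> later leaves logarithms modulo \<open>2 * m\<close> unchanged.\<close>

lemma omega_power_in_base: "\<omega> ^ n \<in> base \<longleftrightarrow> (q + 1) dvd n"
proof -
  have "\<omega> ^ n \<in> base \<longleftrightarrow> [n * q = n] (mod (q\<^sup>2 - 1))"
    by (simp add: mem_base omega_power_eq_iff flip: power_mult)
  also have "\<dots> \<longleftrightarrow> (q\<^sup>2 - 1) dvd n * q - n"
    using q_ge_3 by (subst cong_altdef_nat) auto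
  also have "n * q - n = n * (q - 1)"
    by (simp add: algebra_simps)
  also have "(q\<^sup>2 - 1) dvd n * (q - 1) \<longleftrightarrow> (q + 1) dvd n"
    unfolding q_sq_minus_1 using q_ge_3 by (subst dvd_times_right_cancel_iff) auto
  finally show ?thesis .
qed

lemma omega_power_in_cyclotomic_class:
  assumes N: "N > 0" "N dvd q\<^sup>2 - 1"
  shows "\<omega> ^ n \<in> cyclotomic_class \<omega> N i \<longleftrightarrow> [n = i] (mod N)"
proof
  assume "\<omega> ^ n \<in> cyclotomic_class \<omega> N i"
  then obtain j where "\<omega> ^ n = \<omega> ^ (i + N * j)"
    by (auto simp: cyclotomic_class_def power_add power_mult)
  then have "[n = i + N * j] (mod N)"
    using N(2) unfolding omega_power_eq_iff by (rule cong_dvd_modulus_nat)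
  then show "[n = i] (mod N)"
    by (simp add: cong_def)
next
  assume cong: "[n = i] (mod N)"
  \<comment> \<open>The class is defined with nonnegative \<open>j\<close> only, so the exponent is
    first raised above \<open>i\<close> by a multiple of the order of
    \<open>\<omega>\<close>.\<close>
  define M where "M = n + (q\<^sup>2 - 1) * i"
  have "q\<^sup>2 - 1 > 0"
    unfolding q_sq_minus_1 using q_ge_3 by simp
  then have "1 * i \<le> (q\<^sup>2 - 1) * i"
    by (intro mult_le_mono1) simp
  then have "i \<le> M"
    unfolding M_def by linarith
  moreover have "[M = i] (mod N)"
    using cong N(2) unfolding M_def cong_def by (metis dvd_mult2 mod_mod_cancel mod_mult_self2)
  ultimately obtain j where j: "M = i + N * j"
    by (metis cong_le_nat cong_sym add.commute mult.commute)
  have "\<omega> ^ n = \<omega> ^ M"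
    by (simp add: omega_power_eq_iff M_def cong_def)
  also have "\<dots> = \<omega> ^ i * (\<omega> ^ N) ^ j"
    by (simp add: j power_add power_mult)
  finally show "\<omega> ^ n \<in> cyclotomic_class \<omega> N i"
    by (auto simp: cyclotomic_class_def)
qed

text \<open>The upper bound counts roots of a polynomial; the lower bound exhibits the
  \<open>q - 1\<close> distinct powers of \<open>\<omega> ^ (q + 1)\<close> together with 0.\<close>

lemma card_base: "card base = q"
proof (rule antisym)
  show "card base \<le> q"
    unfolding subfield_of_order_def using q_ge_3 by (intro card_power_fixed_le) simp
  have "inj_on (\<lambda>j. \<omega> ^ ((q + 1) * j)) {..<q - 1}"
  proof (rule inj_onI)
    fix i j assume ij: "i \<in> {..<q - 1}" "j \<in> {..<q - 1}" "\<omega> ^ ((q + 1) * i) = \<omega> ^ ((q + 1) * j)"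
    have "(q + 1) * k < q\<^sup>2 - 1" if "k < q - 1" for k
      unfolding q_sq_minus_1 using that by (intro mult_strict_left_mono) auto
    then have "(q + 1) * i = (q + 1) * j"
      using ij(1,2) ij(3)[unfolded omega_power_eq_iff cong_def] by (simp only: lessThan_iff mod_less)
    then show "i = j"
      by (subst (asm) mult_cancel1) simp
  qed
  then have "card ((\<lambda>j. \<omega> ^ ((q + 1) * j)) ` {..<q - 1}) = q - 1"
    by (simp only: card_image card_lessThan)
  moreover have "(\<lambda>j. \<omega> ^ ((q + 1) * j)) ` {..<q - 1} \<subseteq> base - {0}"
    by (intro image_subsetI DiffI) (simp_all only: omega_power_in_base dvd_triv_left, simp)
  ultimately have "q - 1 \<le> card (base - {0})"
    using card_mono[of "base - {0}"] by (metis finite)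
  then show "q \<le> card base"
    using q_ge_3 by (simp add: card_Diff_singleton)
qed

section \<open>The trace to the subfield and character sums over lines\<close>

text \<open>A square root of a generator of the units of \<open>base\<close>; its line over
  \<open>base\<close> is the kernel of the trace.\<close>

definition anti :: 'a where "anti = \<omega> ^ ((q + 1) div 2)"

lemma anti_nonzero [simp]: "anti \<noteq> 0"
  by (simp add: anti_def)

text \<open>The element \<open>anti ^ (q - 1)\<close> squares to 1, and it is not 1 because
  \<open>anti\<close> lies outside \<open>base\<close>.\<close>

lemma anti_power_q: "anti ^ q = - anti"
proof -
  have h: "(q + 1) div 2 * 2 = q + 1"
    using odd_q by presburger
  have "(anti ^ (q - 1))\<^sup>2 = \<omega> ^ ((q + 1) div 2 * 2 * (q - 1))"
    by (simp only: anti_def mult_ac flip: power_mult)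
  also have "\<dots> = 1"
    by (simp only: h omega_power_order flip: q_sq_minus_1)
  finally have sq: "anti ^ (q - 1) = 1 \<or> anti ^ (q - 1) = -1"
    by (simp add: power2_eq_1_iff)
  have q1: "anti ^ q = anti * anti ^ (q - 1)"
    using q_ge_3 by (cases q) simp_all
  have "anti \<notin> base"
    unfolding anti_def omega_power_in_base using q_ge_3 by (intro nat_dvd_not_less) auto
  then have "anti ^ q \<noteq> anti"
    by (simp add: mem_base)
  then show ?thesis
    using sq unfolding q1 by (auto simp del: power_Suc)
qed

lemma Tr_eq: "Tr x = x + x ^ q"
  by (simp add: field_trace_def numeral_2_eq_2)

lemma Tr_in_base: "Tr x \<in> base"
  unfolding mem_base by (rule field_trace_fixed[OF power_q_sq q])

lemma Tr_add: "Tr (x + y) = Tr x + Tr y"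
  using field_trace_add[of s 2 x y] by (simp add: q)

lemma Tr_mult: "c \<in> base \<Longrightarrow> Tr (c * x) = c * Tr x"
  by (simp add: field_trace_mult mem_base)

lemma Tr_diff: "Tr (x - y) = Tr x - Tr y"
  using Tr_add[of "x - y" y] by simp

text \<open>Trace zero means that the \<open>q\<close>-th power changes the sign, and division by
  \<open>anti\<close> compensates exactly this sign.\<close>

lemma Tr_eq_0_iff: "Tr x = 0 \<longleftrightarrow> x / anti \<in> base"
proof -
  have "Tr x = 0 \<longleftrightarrow> - (x ^ q) = x"
    unfolding Tr_eq by (metis add_eq_0_iff minus_minus)
  also have "\<dots> \<longleftrightarrow> - (x ^ q) / anti = x / anti"
    by (simp only: divide_cancel_right anti_nonzero simp_thms)
  also have "- (x ^ q) / anti = (x / anti) ^ q"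
    by (simp add: power_divide anti_power_q)
  finally show ?thesis
    by (simp only: mem_base)
qed

text \<open>Transitivity of the trace: the second half of the absolute trace sum consists of the
  conjugates of \<open>x ^ q\<close>.\<close>

lemma psi_eq_phi_Tr: "\<psi> x = \<phi> (Tr x)"
proof -
  have split: "(\<Sum>i<s + n. x ^ (p ^ i)) = (\<Sum>i<s. x ^ (p ^ i)) + (\<Sum>i<n. x ^ (p ^ (s + i)))" for n
    by (induction n) (simp_all add: algebra_simps)
  have "field_trace p (2 * s) x = field_trace p s (Tr x)"
    using split[of s]
    by (simp add: field_trace_def mult_2 Tr_eq frobenius_add sum.distrib q numeral_2_eq_2 power_add flip: power_mult)
  then show ?thesis
    by (simp add: canonical_char_def)
qed

lemma psi_add: "\<psi> (x + y) = \<psi> x * \<psi> y"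
  by (intro canonical_char_add) (simp_all flip: q_sq)

lemma phi_add: "x \<in> base \<Longrightarrow> y \<in> base \<Longrightarrow> \<phi> (x + y) = \<phi> x * \<phi> y"
  by (intro canonical_char_add) (simp_all add: mem_base flip: q)

text \<open>On the line through \<open>z\<close> the character is \<open>\<phi> (c * Tr z)\<close>,
  which is trivial exactly when \<open>Tr z = 0\<close>. Otherwise \<open>y / Tr z\<close> witnesses
  nontriviality, for \<open>y\<close> in \<open>base\<close> with nonzero absolute trace.\<close>

lemma psi_sum_line: "(\<Sum>c\<in>base. \<psi> (c * z)) = of_nat q * of_bool (Tr z = 0)"
proof (cases "Tr z = 0")
  case True
  then have "\<psi> (c * z) = 1" if "c \<in> base" for c
    using that by (simp add: psi_eq_phi_Tr Tr_mult)
  then show ?thesis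
    using True by (simp add: card_base)
next
  case False
  obtain y where y: "y \<in> base" "field_trace p s y \<noteq> 0"
    using exists_field_trace_nonzero[OF s, of base] by (auto simp: card_base simp flip: q)
  have "(\<Sum>c\<in>base. \<phi> (c * Tr z)) = 0"
  proof (rule sum_nontrivial_char_eq_0[of base _ "y / Tr z"])
    show "\<phi> (y / Tr z * Tr z) \<noteq> 1"
      using canonical_char_eq_1[of y s] y False by (auto simp: mem_base simp flip: q)
  qed (use y in \<open>auto simp: algebra_simps phi_add base_mult Tr_in_base base_add base_diff base_divide\<close>)
  moreover have "(\<Sum>c\<in>base. \<psi> (c * z)) = (\<Sum>c\<in>base. \<phi> (c * Tr z))"
    by (rule sum.cong) (simp_all add: psi_eq_phi_Tr Tr_mult)
  ultimately show ?thesis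
    using False by simp
qed

lemma psi_sum_line_nonzero: "(\<Sum>c\<in>base - {0}. \<psi> (c * z)) = of_nat q * of_bool (Tr z = 0) - 1"
  using psi_sum_line[of z] by (simp add: sum_diff1)

lemma psi_sum_nonzero: "(\<Sum>x\<in>- {0}. \<psi> (x * z)) = of_nat q ^ 2 * of_bool (z = 0) - 1"
proof -
  have "(\<Sum>x\<in>UNIV. \<psi> (x * z)) = of_nat q ^ 2 * of_bool (z = 0)"
  proof (cases "z = 0")
    case False
    obtain y :: 'a where y: "field_trace p (2 * s) y \<noteq> 0"
      using exists_field_trace_nonzero[of "2 * s" UNIV] s by (auto simp: card_UNIV simp flip: q_sq)
    have "(\<Sum>x\<in>UNIV. \<psi> (x * z)) = 0"
    proof (rule sum_nontrivial_char_eq_0[of UNIV _ "y / z"])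
      show "\<psi> (y / z * z) \<noteq> 1"
        using canonical_char_eq_1[of y "2 * s"] y False by (auto simp flip: q_sq)
    qed (simp_all add: distrib_right psi_add)
    then show ?thesis
      using False by simp
  qed (simp add: card_UNIV)
  then show ?thesis
    by (simp add: Compl_eq_Diff_UNIV sum_diff1)
qed

section \<open>Unions of punctured lines\<close>

definition cone :: "'a set \<Rightarrow> bool" where
  "cone D \<longleftrightarrow> 0 \<notin> D \<and> (\<forall>c\<in>base - {0}. \<forall>x\<in>D. c * x \<in> D)"

lemma cone_mult_iff:
  assumes "cone D" "c \<in> base" "c \<noteq> 0"
  shows "c * x \<in> D \<longleftrightarrow> x \<in> D"
proof
  assume "c * x \<in> D"
  moreover have "1 / c \<in> base - {0}"
    using assms base_divide[of 1 c] by simp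
  ultimately have "1 / c * (c * x) \<in> D"
    using assms(1) unfolding cone_def by blast
  then show "x \<in> D"
    using assms by simp
qed (use assms in \<open>auto simp: cone_def\<close>)

lemma cone_line:
  assumes "cone D" "v \<noteq> 0"
  shows "{x\<in>D. x / v \<in> base} = (if v \<in> D then (\<lambda>c. c * v) ` (base - {0}) else {})"
proof -
  have "x \<in> (\<lambda>c. c * v) ` (base - {0}) \<and> v \<in> D" if "x \<in> D" "x / v \<in> base" for x
  proof -
    have x: "x = x / v * v" "x / v \<noteq> 0"
      using that assms by (auto simp: cone_def)
    then have "v \<in> D"
      using cone_mult_iff[OF assms(1) that(2), of v] that(1) by simp
    then show ?thesis
      using x that by blast
  qed
  moreover have "c * v \<in> D \<and> c * v / v \<in> base" if "c \<in> base - {0}" "v \<in> D" for c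
    using that assms by (auto simp: cone_def)
  ultimately show ?thesis
    by auto
qed

lemma cone_scale:
  assumes "cone D" "c \<in> base - {0}" "(x, y) \<in> {(x, x * y) | x y. x \<in> D \<and> y \<in> A}"
  shows "(c * x, c * y) \<in> {(x, x * y) | x y. x \<in> D \<and> y \<in> A}"
proof -
  obtain z where z: "y = x * z" "x \<in> D" "z \<in> A"
    using assms(3) by blast
  moreover have "c * x \<in> D"
    using assms(1,2) z(2) unfolding cone_def by blast
  moreover have "c * y = c * x * z"
    by (simp add: z(1))
  ultimately show ?thesis
    by blast
qed

lemma sum_cone_line:
  fixes f :: "'a \<Rightarrow> complex"
  assumes "cone D" "v \<noteq> 0"
  shows "(\<Sum>x | x \<in> D \<and> x / v \<in> base. f x) = of_bool (v \<in> D) * (\<Sum>c\<in>base - {0}. f (c * v))"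
proof -
  have "inj_on (\<lambda>c. c * v) (base - {0})"
    using assms by (auto simp: inj_on_def)
  then show ?thesis
    by (simp add: cone_line[OF assms] sum.reindex)
qed

text \<open>Averaging over multiplications by nonzero \<open>c\<close> in \<open>base\<close> leaves
  the sum unchanged and replaces each term by a line sum. It remains to count the \<open>x\<close>
  in \<open>D\<close> with \<open>Tr (x * z) = 0\<close>; these lie on the line through
  \<open>anti / z\<close>, which \<open>D\<close> contains or avoids as a whole.\<close>

lemma psi_sum_cone:
  assumes D: "cone D" and z: "z \<noteq> 0"
  shows "(\<Sum>x\<in>D. \<psi> (x * z)) = of_nat q * of_bool (anti / z \<in> D) - of_nat (card D) / (of_nat q - 1)"
proof -
  let ?S = "\<Sum>x\<in>D. \<psi> (x * z)"
  have inv: "(\<Sum>x\<in>D. \<psi> (c * (x * z))) = ?S" if c: "c \<in> base - {0}" for c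
  proof (rule sum.reindex_bij_witness[of _ "\<lambda>x. 1 / c * x" "\<lambda>x. c * x"])
    show "1 / c * x \<in> D" if "x \<in> D" for x
      using that c base_divide[of 1 c] by (subst cone_mult_iff[OF D]) auto
  qed (use c D in \<open>auto simp: cone_def mult.assoc\<close>)
  have "(\<Sum>x\<in>D. of_bool (Tr (x * z) = 0)) = (\<Sum>x | x \<in> D \<and> x / (anti / z) \<in> base. 1 :: complex)"
    by (simp add: Tr_eq_0_iff Int_def)
  also have "\<dots> = of_bool (anti / z \<in> D) * (of_nat q - 1)"
    using sum_cone_line[OF D, of "anti / z" "\<lambda>_. 1"] z q_ge_3 card_base
    by (simp add: card_Diff_singleton of_nat_diff)
  finally have cnt: "(\<Sum>x\<in>D. of_bool (Tr (x * z) = 0)) = of_bool (anti / z \<in> D) * (of_nat q - 1 :: complex)" .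
  have "(of_nat q - 1) * ?S = (\<Sum>c\<in>base - {0}. \<Sum>x\<in>D. \<psi> (c * (x * z)))"
    using q_ge_3 card_base by (simp add: inv card_Diff_singleton of_nat_diff)
  also have "\<dots> = (\<Sum>x\<in>D. \<Sum>c\<in>base - {0}. \<psi> (c * (x * z)))"
    by (rule sum.swap)
  also have "\<dots> = of_nat q * (\<Sum>x\<in>D. of_bool (Tr (x * z) = 0)) - of_nat (card D)"
    unfolding psi_sum_line_nonzero sum_subtractf sum_distrib_left by simp
  also have "\<dots> = (of_nat q - 1) * (of_nat q * of_bool (anti / z \<in> D)) - of_nat (card D)"
    unfolding cnt by simp
  finally have "(of_nat q - 1) * ?S = (of_nat q - 1) * (of_nat q * of_bool (anti / z \<in> D)) - of_nat (card D)" .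
  moreover have "(of_nat q :: complex) \<noteq> of_nat 1"
    using q_ge_3 unfolding of_nat_eq_iff by simp
  then have "(of_nat q - 1 :: complex) \<noteq> 0"
    by simp
  ultimately show ?thesis
    by (metis diff_divide_distrib nonzero_mult_div_cancel_left)
qed

section \<open>Preimages under the trace\<close>

text \<open>The pair of traces is a bijection onto \<open>base \<times> base\<close>: a nonzero
  element killed by both would give \<open>\<theta>\<close> as a quotient of two elements of
  \<open>base\<close>, and the cardinalities agree.\<close>

lemma card_trace_preimage2:
  assumes "\<theta> \<notin> base" "T0 \<subseteq> base" "T1 \<subseteq> base"
  shows "card {y. Tr y \<in> T0 \<and> Tr (y * \<theta>) \<in> T1} = card T0 * card T1"
proof -
  let ?f = "\<lambda>y. (Tr y, Tr (y * \<theta>))"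
  have "inj ?f"
  proof (rule injI)
    fix y z assume "?f y = ?f z"
    then have "(y - z) / anti \<in> base" "(y - z) * \<theta> / anti \<in> base"
      unfolding Tr_eq_0_iff[symmetric] left_diff_distrib Tr_diff by simp_all
    then have "y - z \<noteq> 0 \<Longrightarrow> \<theta> \<in> base"
      using base_divide[of "(y - z) * \<theta> / anti" "(y - z) / anti"] by simp
    then show "y = z"
      using assms(1) by auto
  qed
  have "range ?f = base \<times> base"
  proof (rule card_seteq)
    show "card (base \<times> base) \<le> card (range ?f)"
      using \<open>inj ?f\<close> by (simp add: card_image card_base card_UNIV power2_eq_square card_cartesian_product)
  qed (auto simp: Tr_in_base)
  then have "?f ` {y. Tr y \<in> T0 \<and> Tr (y * \<theta>) \<in> T1} = T0 \<times> T1"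
    using assms(2,3)
  proof (intro equalityI subsetI)
    fix z assume "z \<in> T0 \<times> T1"
    then have "z \<in> range ?f"
      using \<open>range ?f = base \<times> base\<close> assms(2,3) by blast
    with \<open>z \<in> T0 \<times> T1\<close> show "z \<in> ?f ` {y. Tr y \<in> T0 \<and> Tr (y * \<theta>) \<in> T1}"
      by blast
  qed blast
  then have "card (?f ` {y. Tr y \<in> T0 \<and> Tr (y * \<theta>) \<in> T1}) = card T0 * card T1"
    by (simp only: card_cartesian_product)
  then show ?thesis
    by (simp only: card_image[OF inj_on_subset[OF \<open>inj ?f\<close> subset_UNIV]])
qed

lemma card_trace_preimage:
  assumes "\<theta> \<noteq> 0" "T \<subseteq> base"
  shows "card {y. Tr (y * \<theta>) \<in> T} = q * card T"
proof -
  \<comment> \<open>Here \<open>\<omega>\<close> is just an auxiliary element outside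
    \<open>base\<close>; requiring the second trace only to lie in \<open>base\<close> leaves a
    single condition.\<close>
  have "\<omega> \<notin> base"
    using omega_power_in_base[of 1] q_ge_3 by simp
  from card_trace_preimage2[OF this assms(2) subset_refl]
  have "card {y. Tr y \<in> T} = q * card T"
    by (simp add: Tr_in_base card_base)
  moreover have "bij_betw (\<lambda>y. y * \<theta>) {y. Tr (y * \<theta>) \<in> T} {y. Tr y \<in> T}"
    by (rule bij_betw_byWitness[of _ "\<lambda>y. y / \<theta>"]) (use assms in auto)
  ultimately show ?thesis
    by (simp add: bij_betw_same_card)
qed

text \<open>Only the line through \<open>\<theta> / b\<close> survives, and it meets
  \<open>D\<close> fully or not at all. On it, line sums reduce the question to counting the
  \<open>y\<close> in \<open>S\<close> that have the same twisted trace as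
  \<open>- a / b\<close>.\<close>

lemma psi_sum_cone_trace_preimage:
  assumes D: "cone D" and \<theta>: "\<theta> \<noteq> 0" and T: "T \<subseteq> base" and b: "b \<noteq> 0"
    and S: "S = {y. Tr (y * \<theta>) \<in> T}"
  shows "(\<Sum>x\<in>D. \<Sum>y\<in>S. \<psi> (x * (a + b * y))) =
    of_bool (\<theta> / b \<in> D) * (of_nat q ^ 2 * of_bool (- a / b \<in> S) - of_nat q * of_nat (card T))"
proof -
  let ?f = "\<lambda>x. \<Sum>y\<in>S. \<psi> (x * (a + b * y))"
  have vanish: "?f x = 0" if "x / (\<theta> / b) \<notin> base" for x
  proof -
    \<comment> \<open>The line through \<open>w\<close> is the kernel of
      \<open>\<lambda>y. Tr (y * \<theta>)\<close>, so \<open>S\<close> is invariant under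
      translation along it. Averaging over these translations produces a line sum that vanishes off
      the line through \<open>\<theta> / b\<close>.\<close>
    define w where "w = anti / \<theta>"
    have "Tr (r * w * \<theta>) = 0" if "r \<in> base" for r
      using that \<theta> by (simp add: w_def Tr_eq_0_iff)
    then have shift: "y + r * w \<in> S \<longleftrightarrow> y \<in> S" if "r \<in> base" for r y
      using that by (simp add: S distrib_right Tr_add)
    have invariant: "?f x = (\<Sum>y\<in>S. \<psi> (x * (a + b * (y + r * w))))" if r: "r \<in> base" for r
      by (rule sum.reindex_bij_witness[of _ "\<lambda>y. y + r * w" "\<lambda>y. y - r * w"])
        (use shift[OF r] shift[OF r, of "y - r * w" for y] in auto)
    have "of_nat q * ?f x = (\<Sum>r\<in>base. ?f x)"
      by (simp add: card_base)
    also have "\<dots> = (\<Sum>r\<in>base. \<Sum>y\<in>S. \<psi> (x * (a + b * (y + r * w))))"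
      by (rule sum.cong[OF refl invariant])
    also have "\<dots> = (\<Sum>y\<in>S. \<Sum>r\<in>base. \<psi> (x * (a + b * (y + r * w))))"
      by (rule sum.swap)
    also have "\<dots> = (\<Sum>y\<in>S. \<psi> (x * (a + b * y)) * (\<Sum>r\<in>base. \<psi> (r * (x * b * w))))"
      unfolding sum_distrib_left psi_add[symmetric] by (simp add: algebra_simps)
    also have "(\<Sum>r\<in>base. \<psi> (r * (x * b * w))) = 0"
    proof -
      have "x * b * w / anti = x / (\<theta> / b)"
        by (simp add: w_def)
      then have "Tr (x * b * w) \<noteq> 0"
        unfolding Tr_eq_0_iff using that by simp
      then show ?thesis
        unfolding psi_sum_line by simp
    qed
    finally show ?thesis
      using q_ge_3 by simp
  qed
  \<comment> \<open>These \<open>y\<close> form one fibre of the map defining \<open>S\<close>, so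
    they lie in \<open>S\<close> all together or not at all, according to whether
    \<open>- a / b\<close> does.\<close>
  have "{y\<in>S. Tr (\<theta> * (a / b + y)) = 0} = (if - a / b \<in> S then {y. Tr (y * \<theta>) \<in> {Tr (- a / b * \<theta>)}} else {})"
  proof -
    have "Tr (\<theta> * (a / b + y)) = Tr (y * \<theta>) - Tr (- a / b * \<theta>)" for y
      unfolding Tr_diff[symmetric] by (rule arg_cong[of _ _ Tr]) (simp add: algebra_simps)
    then show ?thesis
      by (auto simp: S)
  qed
  then have cnt: "card {y\<in>S. Tr (\<theta> * (a / b + y)) = 0} = q * of_bool (- a / b \<in> S)"
    using card_trace_preimage[OF \<theta>, of "{Tr (- a / b * \<theta>)}"] Tr_in_base by simp
  have "(\<Sum>x\<in>D. ?f x) = (\<Sum>x | x \<in> D \<and> x / (\<theta> / b) \<in> base. ?f x)"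
    by (rule sum.mono_neutral_right) (use vanish in auto)
  also have "\<dots> = of_bool (\<theta> / b \<in> D) * (\<Sum>c\<in>base - {0}. ?f (c * (\<theta> / b)))"
    using \<theta> b by (intro sum_cone_line D) simp
  also have "(\<Sum>c\<in>base - {0}. ?f (c * (\<theta> / b))) = (\<Sum>y\<in>S. \<Sum>c\<in>base - {0}. \<psi> (c * (\<theta> * (a / b + y))))"
  proof -
    have "c * (\<theta> / b) * (a + b * y) = c * (\<theta> * (a / b + y))" for c y
      using b by (simp add: field_simps)
    then show ?thesis
      by (subst sum.swap) simp
  qed
  also have "\<dots> = of_nat q * of_nat (card {y\<in>S. Tr (\<theta> * (a / b + y)) = 0}) - of_nat (card S)"
    unfolding psi_sum_line_nonzero sum_subtractf by (simp add: Int_def flip: sum_distrib_left)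
  also have "card S = q * card T"
    using card_trace_preimage[OF \<theta> T] by (simp add: S)
  finally show ?thesis
    by (simp add: cnt power2_eq_square)
qed

end

subsection \<open>Splitting the nonzero elements into two cones\<close>

text \<open>Here \<open>\<nu>\<close> stands for \<open>\<omega> ^ m\<close>, and
  \<open>swap\<close> records what the cyclotomic construction and the choice of \<open>K\<close>
  provide.\<close>

locale cone_halves = quadratic_extension +
  fixes \<nu> :: 'a and D0 D1 T0 T1 S0 S1 :: "'a set"
  assumes nu: "\<nu> \<notin> base"
    and cone0: "cone D0"
    and D1_eq: "D1 = - {0} - D0"
    and swap: "x \<noteq> 0 \<Longrightarrow> \<nu> * x \<in> D0 \<longleftrightarrow> x \<notin> D0"
    and T0: "T0 \<subseteq> base" and T1: "T1 \<subseteq> base"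
    and S0: "S0 = {x. Tr x \<in> T0}" and S1: "S1 = {x. Tr (x * \<nu>) \<in> T1}"
begin

lemma nu_nonzero [simp]: "\<nu> \<noteq> 0"
  using nu by auto

lemma zero_notin_D0 [simp]: "0 \<notin> D0"
  using cone0 by (simp add: cone_def)

lemma mem_D1: "x \<in> D1 \<longleftrightarrow> x \<noteq> 0 \<and> x \<notin> D0"
  by (auto simp: D1_eq)

lemma D0_Un_D1: "D0 \<union> D1 = - {0}" and D0_Int_D1: "D0 \<inter> D1 = {}"
  by (auto simp: D1_eq)

lemma cone1: "cone D1"
  unfolding cone_def using cone_mult_iff[OF cone0] by (auto simp: mem_D1)

lemma card_D: "card D0 = card D1" "2 * card D0 = q\<^sup>2 - 1"
proof -
  have "bij_betw (\<lambda>x. \<nu> * x) D1 D0"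
  proof (rule bij_betw_byWitness[of _ "\<lambda>x. x / \<nu>"])
    show "(\<lambda>x. x / \<nu>) ` D0 \<subseteq> D1"
    proof
      fix y assume "y \<in> (\<lambda>x. x / \<nu>) ` D0"
      then have y: "\<nu> * y \<in> D0" by auto
      then have "y \<noteq> 0" by auto
      with y show "y \<in> D1" by (simp add: mem_D1 swap)
    qed
  qed (auto simp: mem_D1 swap)
  then show eq: "card D0 = card D1"
    by (simp add: bij_betw_same_card)
  have "card D0 + card D1 = card (- {0 :: 'a})"
    by (simp add: card_Un_disjoint D0_Int_D1 flip: D0_Un_D1)
  then show "2 * card D0 = q\<^sup>2 - 1"
    by (simp add: eq Compl_eq_Diff_UNIV card_Diff_singleton card_UNIV)
qed

lemma of_nat_card_D0: "of_nat (card D0) = (of_nat q ^ 2 - 1) / (2 :: complex)"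
proof -
  have "q\<^sup>2 \<ge> 1"
    using q_ge_3 by simp
  have "2 * of_nat (card D0) = (of_nat (2 * card D0) :: complex)"
    by simp
  also have "\<dots> = of_nat q ^ 2 - 1"
    unfolding card_D(2) using \<open>q\<^sup>2 \<ge> 1\<close> by (simp only: of_nat_diff of_nat_power of_nat_1)
  finally show ?thesis
    by (simp add: mult.commute)
qed

lemma card_D_div: "of_nat (card D0) / (of_nat q - 1) = (of_nat q + 1) / (2 :: complex)"
proof -
  have "(of_nat q :: complex) \<noteq> of_nat 1"
    using q_ge_3 unfolding of_nat_eq_iff by simp
  then show ?thesis
    unfolding of_nat_card_D0 by (simp add: field_simps power2_eq_square)
qed

lemma psi_sum_D0: "z \<noteq> 0 \<Longrightarrow>
    (\<Sum>x\<in>D0. \<psi> (x * z)) = of_nat q * of_bool (anti / z \<in> D0) - (of_nat q + 1) / 2"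
  unfolding card_D_div[symmetric] by (rule psi_sum_cone[OF cone0])

lemma psi_sum_D1: "z \<noteq> 0 \<Longrightarrow>
    (\<Sum>x\<in>D1. \<psi> (x * z)) = of_nat q * of_bool (anti / z \<in> D1) - (of_nat q + 1) / 2"
  unfolding card_D_div[symmetric] card_D(1) by (rule psi_sum_cone[OF cone1])

lemma card_S0: "card S0 = q * card T0" and card_S1: "card S1 = q * card T1"
  using card_trace_preimage[OF _ T0, of 1] card_trace_preimage[OF nu_nonzero T1]
  by (simp_all add: S0 S1)

lemma card_S0_Int_S1: "card (S0 \<inter> S1) = card T0 * card T1"
  using card_trace_preimage2[OF nu T0 T1] by (simp add: S0 S1 Collect_conj_eq)

section \<open>The set common to both constructions, its size and its character sums\<close>

definition twisted :: "('a \<times> 'a) set" where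
  "twisted = {(x, x * y) | x y. x \<in> D0 \<and> y \<in> S0 - S1} \<union> {(x, x * y) | x y. x \<in> D1 \<and> y \<in> S1 - S0}"

lemma twisted_fst_nonzero: "(0, y) \<notin> twisted"
  by (auto simp: twisted_def mem_D1)

lemma twisted_scale: "c \<in> base - {0} \<Longrightarrow> (x, y) \<in> twisted \<Longrightarrow> (c * x, c * y) \<in> twisted"
  unfolding twisted_def
  by (erule UnE) (rule UnI1, erule (1) cone_scale[OF cone0], rule UnI2, erule (1) cone_scale[OF cone1])

lemma sum_twisted:
  fixes f :: "'a \<times> 'a \<Rightarrow> 'b::comm_monoid_add"
  shows "sum f twisted = (\<Sum>x\<in>D0. \<Sum>y\<in>S0 - S1. f (x, x * y)) + (\<Sum>x\<in>D1. \<Sum>y\<in>S1 - S0. f (x, x * y))"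
proof -
  have "sum f twisted = sum f {(x, x * y) | x y. x \<in> D0 \<and> y \<in> S0 - S1}
      + sum f {(x, x * y) | x y. x \<in> D1 \<and> y \<in> S1 - S0}"
    unfolding twisted_def by (rule sum.union_disjoint) (auto simp: mem_D1)
  moreover have "0 \<notin> D1"
    by (simp add: mem_D1)
  ultimately show ?thesis
    by (simp only: sum_scaled_pairs[OF zero_notin_D0] sum_scaled_pairs[OF \<open>0 \<notin> D1\<close>])
qed

lemma card_S0_Diff_S1: "of_nat (card (S0 - S1)) = of_nat (card T0) * (of_nat q - of_nat (card T1) :: complex)"
  and card_S1_Diff_S0: "of_nat (card (S1 - S0)) = of_nat (card T1) * (of_nat q - of_nat (card T0) :: complex)"
proof -
  have "card (S0 - S1) + card T0 * card T1 = q * card T0"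
    unfolding card_S0_Int_S1[symmetric] card_S0[symmetric]
    by (subst card_Un_disjoint[symmetric]) (auto intro: arg_cong[of _ _ card])
  then have "of_nat (card (S0 - S1) + card T0 * card T1) = (of_nat (q * card T0) :: complex)"
    by simp
  then show "of_nat (card (S0 - S1)) = of_nat (card T0) * (of_nat q - of_nat (card T1) :: complex)"
    by (simp add: algebra_simps eq_diff_eq)
  have "card (S1 - S0) + card T0 * card T1 = q * card T1"
    unfolding card_S0_Int_S1[symmetric] card_S1[symmetric]
    by (subst card_Un_disjoint[symmetric]) (auto intro: arg_cong[of _ _ card])
  then have "of_nat (card (S1 - S0) + card T0 * card T1) = (of_nat (q * card T1) :: complex)"
    by simp
  then show "of_nat (card (S1 - S0)) = of_nat (card T1) * (of_nat q - of_nat (card T0) :: complex)"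
    by (simp add: algebra_simps eq_diff_eq)
qed

lemma card_twisted:
  "of_nat (card twisted) = (of_nat q ^ 2 - 1) / 2 *
     (of_nat (card T0) * (of_nat q - of_nat (card T1)) + of_nat (card T1) * (of_nat q - of_nat (card T0)) :: complex)"
proof -
  have "of_nat (card twisted) = (of_nat (card D0) * of_nat (card (S0 - S1)) + of_nat (card D1) * of_nat (card (S1 - S0)) :: complex)"
    using sum_twisted[of "\<lambda>_. 1 :: complex"] by simp
  then show ?thesis
    unfolding card_D(1)[symmetric] of_nat_card_D0 card_S0_Diff_S1 card_S1_Diff_S0 by (simp only: distrib_left)
qed

lemma char_sum_twisted_0:
  assumes "a \<noteq> 0"
  shows "char_sum \<psi> a 0 twisted =
    (of_nat q * of_bool (anti / a \<in> D0) - (of_nat q + 1) / 2) * (of_nat (card T0) * (of_nat q - of_nat (card T1)))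
    + (of_nat q * of_bool (anti / a \<in> D1) - (of_nat q + 1) / 2) * (of_nat (card T1) * (of_nat q - of_nat (card T0)))"
proof -
  have "char_sum \<psi> a 0 twisted = (\<Sum>x\<in>D0. \<psi> (x * a)) * of_nat (card (S0 - S1)) + (\<Sum>x\<in>D1. \<psi> (x * a)) * of_nat (card (S1 - S0))"
    unfolding char_sum_def sum_twisted by (simp add: mult.commute sum_distrib_left)
  then show ?thesis
    unfolding psi_sum_D0[OF assms] psi_sum_D1[OF assms] card_S0_Diff_S1 card_S1_Diff_S0 .
qed

lemma char_sum_twisted:
  assumes "b \<noteq> 0"
  shows "char_sum \<psi> a b twisted =
    of_nat (card T0) * of_nat (card T1) - of_nat q ^ 2 * of_bool (- a / b \<in> S0) * of_bool (- a / b \<in> S1)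
    + of_bool (1 / b \<in> D0) * of_nat q * (of_nat q * of_bool (- a / b \<in> S0) + of_nat q * of_bool (- a / b \<in> S1)
        - of_nat (card T0) - of_nat (card T1))"
proof -
  let ?g = "\<lambda>x y. \<psi> (x * (a + b * y))"
  have inner: "(\<Sum>y\<in>S0 - S1. ?g x y) = (\<Sum>y\<in>S0. ?g x y) - (\<Sum>y\<in>S0 \<inter> S1. ?g x y)"
    "(\<Sum>y\<in>S1 - S0. ?g x y) = (\<Sum>y\<in>S1. ?g x y) - (\<Sum>y\<in>S0 \<inter> S1. ?g x y)" for x
    using sum.Int_Diff[of S0 "?g x" S1] sum.Int_Diff[of S1 "?g x" S0] by (simp_all add: Int_commute)
  have zero: "a + b * y = 0 \<longleftrightarrow> y = - a / b" for y
  proof -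
    have "a + b * y = b * (y - - a / b)"
      using assms by (simp add: right_diff_distrib distrib_left)
    then show ?thesis
      by (simp only: mult_eq_0_iff right_minus_eq assms simp_thms)
  qed
  \<comment> \<open>The common part runs over all nonzero \<open>x\<close>, so after exchanging the
    sums only \<open>y = - a / b\<close> gives more than the constant \<open>- 1\<close>.\<close>
  have "(\<Sum>x\<in>D0. \<Sum>y\<in>S0 \<inter> S1. ?g x y) + (\<Sum>x\<in>D1. \<Sum>y\<in>S0 \<inter> S1. ?g x y) = (\<Sum>x\<in>- {0}. \<Sum>y\<in>S0 \<inter> S1. ?g x y)"
    unfolding D0_Un_D1[symmetric] by (subst sum.union_disjoint) (simp_all add: D0_Int_D1)
  also have "\<dots> = (\<Sum>y\<in>S0 \<inter> S1. of_nat q ^ 2 * of_bool (y = - a / b) - 1)"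
    unfolding zero[symmetric] psi_sum_nonzero[symmetric] by (rule sum.swap)
  also have "\<dots> = of_nat q ^ 2 * (\<Sum>y\<in>S0 \<inter> S1. of_bool (y = - a / b)) - of_nat (card T0) * of_nat (card T1)"
    unfolding sum_subtractf sum_distrib_left by (simp add: card_S0_Int_S1)
  also have "(\<Sum>y\<in>S0 \<inter> S1. of_bool (y = - a / b)) = (of_bool (- a / b \<in> S0) * of_bool (- a / b \<in> S1) :: complex)"
    by (auto simp: of_bool_def)
  finally have both: "(\<Sum>x\<in>D0. \<Sum>y\<in>S0 \<inter> S1. ?g x y) + (\<Sum>x\<in>D1. \<Sum>y\<in>S0 \<inter> S1. ?g x y) =
    of_nat q ^ 2 * (of_bool (- a / b \<in> S0) * of_bool (- a / b \<in> S1)) - of_nat (card T0) * of_nat (card T1)" .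
  \<comment> \<open>The line relevant for \<open>S1\<close> passes through \<open>\<nu> / b\<close>,
    not \<open>1 / b\<close>; the swap makes both halves contribute under the same condition
    \<open>1 / b \<in> D0\<close>.\<close>
  have "\<nu> / b \<in> D1 \<longleftrightarrow> 1 / b \<in> D0"
    using swap[of "1 / b"] assms by (simp add: mem_D1)
  then have s1: "(\<Sum>x\<in>D1. \<Sum>y\<in>S1. ?g x y) =
    of_bool (1 / b \<in> D0) * (of_nat q ^ 2 * of_bool (- a / b \<in> S1) - of_nat q * of_nat (card T1))"
    by (simp only: psi_sum_cone_trace_preimage[OF cone1 nu_nonzero T1 assms S1])
  have s0: "(\<Sum>x\<in>D0. \<Sum>y\<in>S0. ?g x y) =
    of_bool (1 / b \<in> D0) * (of_nat q ^ 2 * of_bool (- a / b \<in> S0) - of_nat q * of_nat (card T0))"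
    by (rule psi_sum_cone_trace_preimage[OF cone0 _ T0 assms]) (simp_all add: S0)
  have "char_sum \<psi> a b twisted = (\<Sum>x\<in>D0. \<Sum>y\<in>S0 - S1. ?g x y) + (\<Sum>x\<in>D1. \<Sum>y\<in>S1 - S0. ?g x y)"
    unfolding char_sum_def sum_twisted by (simp add: algebra_simps)
  also have "\<dots> = (\<Sum>x\<in>D0. \<Sum>y\<in>S0. ?g x y) + (\<Sum>x\<in>D1. \<Sum>y\<in>S1. ?g x y)
      - ((\<Sum>x\<in>D0. \<Sum>y\<in>S0 \<inter> S1. ?g x y) + (\<Sum>x\<in>D1. \<Sum>y\<in>S0 \<inter> S1. ?g x y))"
    unfolding inner sum_subtractf by simp
  finally show ?thesis
    unfolding both s0 s1 by (simp add: algebra_simps power2_eq_square)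
qed

section \<open>Recognizing type Q and checking both constructions\<close>

text \<open>With \<open>\<alpha>\<close>, \<open>\<beta>\<close>, \<open>\<delta>\<close> the three
  truth values, the bracket is \<open>- \<alpha> * \<beta>\<close> for \<open>\<delta> = 0\<close>
  and \<open>- (1 - \<alpha>) * (1 - \<beta>)\<close> for \<open>\<delta> = 1\<close>. The bounds on
  \<open>T0\<close> and \<open>T1\<close> ensure that both values occur.\<close>

lemma type_QI:
  assumes zero: "(0, 0) \<notin> E"
    and scale: "\<And>c x y. c \<in> base - {0} \<Longrightarrow> (x, y) \<in> E \<Longrightarrow> (c * x, c * y) \<in> E"
    and card: "of_nat (card E) = (of_nat q ^ 4 - 1) / (4 :: complex)"
    and char_0: "\<And>a. a \<noteq> 0 \<Longrightarrow> char_sum \<psi> a 0 E \<in> {(of_nat q ^ 2 - 1) / 4, (- 3 * of_nat q ^ 2 - 1) / 4}"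
    and char: "\<And>a b. b \<noteq> 0 \<Longrightarrow> char_sum \<psi> a b E = (of_nat q ^ 2 - 1) / 4 + of_nat q ^ 2 *
      (of_bool (1 / b \<in> D0) * (of_bool (- a / b \<in> S0) + of_bool (- a / b \<in> S1) - 1)
        - of_bool (- a / b \<in> S0) * of_bool (- a / b \<in> S1))"
    and T: "0 < card T0" "card T0 < q" "0 < card T1"
  shows "type_Q \<psi> q E"
  unfolding type_Q_def
proof (intro conjI)
  have "of_real (real (card E)) = (of_real ((real q ^ 4 - 1) / 4) :: complex)"
    using card by simp
  then show "real (card E) = (real q ^ 4 - 1) / 4"
    by (simp only: of_real_eq_iff)
  let ?v1 = "(of_nat q ^ 2 - 1) / 4 :: complex" and ?v2 = "(- 3 * of_nat q ^ 2 - 1) / 4 :: complex"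
  have v2: "?v2 = ?v1 + of_nat q ^ 2 * - 1"
    by (simp add: field_simps)
  show "{char_sum \<psi> a b E | a b. (a, b) \<noteq> (0, 0)} = {?v1, ?v2}"
  proof (intro equalityI subsetI)
    fix v assume "v \<in> {char_sum \<psi> a b E | a b. (a, b) \<noteq> (0, 0)}"
    then obtain a b where v: "v = char_sum \<psi> a b E" and ab: "a \<noteq> 0 \<or> b \<noteq> 0"
      by auto
    show "v \<in> {?v1, ?v2}"
    proof (cases "b = 0")
      case True
      then show ?thesis
        using ab char_0 v by simp
    next
      case False
      then show ?thesis
        unfolding v v2 char[OF False] by (auto simp: of_bool_def)
    qed
  next
    \<comment> \<open>For attainment take \<open>1 / b = d\<close> outside \<open>D0\<close>: a
      point outside \<open>S0\<close> then gives the first value and a point of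
      \<open>S0 \<inter> S1\<close> the second.\<close>
    have "card D0 > 0"
    proof (rule ccontr)
      assume "\<not> card D0 > 0"
      then have "q\<^sup>2 \<le> 1"
        using card_D(2) by simp
      moreover have "q\<^sup>2 \<ge> 3\<^sup>2"
        using q_ge_3 by (rule power_mono) simp
      ultimately show False by simp
    qed
    then have "D1 \<noteq> {}"
      using card_D(1) by auto
    then obtain d where d: "d \<noteq> 0" "d \<notin> D0"
      by (auto simp: mem_D1)
    have vals: "char_sum \<psi> (- y / d) (1 / d) E = ?v1 + of_nat q ^ 2 * (- (of_bool (y \<in> S0) * of_bool (y \<in> S1)))" for y
      using char[of "1 / d" "- y / d"] d by simp
    have "S0 \<noteq> UNIV"
      using card_S0 T(2) q_ge_3 card_UNIV by (auto simp: power2_eq_square)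
    then obtain y0 where "y0 \<notin> S0" by auto
    then have "?v1 = char_sum \<psi> (- y0 / d) (1 / d) E"
      unfolding vals by simp
    moreover have "S0 \<inter> S1 \<noteq> {}"
      using card_S0_Int_S1 T by auto
    then obtain y1 where "y1 \<in> S0" "y1 \<in> S1" by auto
    then have "?v2 = char_sum \<psi> (- y1 / d) (1 / d) E"
      unfolding vals v2 by simp
    moreover have "1 / d \<noteq> 0"
      using d by simp
    ultimately show "v \<in> {char_sum \<psi> a b E | a b. (a, b) \<noteq> (0, 0)}" if "v \<in> {?v1, ?v2}" for v
      using that by blast
  qed
qed (use zero scale in auto)

lemma of_nat_half:
  "of_nat ((q - 1) div 2) = (of_nat q - 1) / (2 :: complex)"
  "of_nat ((q + 1) div 2) = (of_nat q + 1) / (2 :: complex)"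
proof -
  obtain k where "q = 2 * k + 1"
    using odd_q by (elim oddE)
  then show "of_nat ((q - 1) div 2) = (of_nat q - 1) / (2 :: complex)"
    "of_nat ((q + 1) div 2) = (of_nat q + 1) / (2 :: complex)"
    by (simp_all add: field_simps)
qed

lemma anti_divide_mem_D1: "a \<noteq> 0 \<Longrightarrow> anti / a \<in> D1 \<longleftrightarrow> anti / a \<notin> D0"
  by (simp add: mem_D1)

text \<open>These sizes have sum \<open>q\<close> and product \<open>(q\<^sup>2 - 1) / 4\<close>,
  which brings \<open>char_sum_twisted\<close> directly into the form of
  \<open>type_QI\<close>.\<close>

lemma type_Q_twisted:
  assumes t0: "card T0 = (q - 1) div 2" and t1: "card T1 = (q + 1) div 2"
  shows "type_Q \<psi> q twisted"
proof (rule type_QI)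
  have c: "of_nat (card T0) = (of_nat q - 1) / (2 :: complex)" "of_nat (card T1) = (of_nat q + 1) / (2 :: complex)"
    unfolding t0 t1 by (rule of_nat_half)+
  show "of_nat (card twisted) = (of_nat q ^ 4 - 1) / (4 :: complex)"
    unfolding card_twisted c by (simp add: field_simps power2_eq_square power4_eq_xxxx)
  show "char_sum \<psi> a 0 twisted \<in> {(of_nat q ^ 2 - 1) / 4, (- 3 * of_nat q ^ 2 - 1) / 4}" if "a \<noteq> 0" for a
    unfolding char_sum_twisted_0[OF that] c anti_divide_mem_D1[OF that]
    by (cases "anti / a \<in> D0") (simp_all add: field_simps power2_eq_square)
  show "char_sum \<psi> a b twisted = (of_nat q ^ 2 - 1) / 4 + of_nat q ^ 2 *
      (of_bool (1 / b \<in> D0) * (of_bool (- a / b \<in> S0) + of_bool (- a / b \<in> S1) - 1)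
        - of_bool (- a / b \<in> S0) * of_bool (- a / b \<in> S1))" if "b \<noteq> 0" for a b
    unfolding char_sum_twisted[OF that] c by (simp add: field_simps power2_eq_square)
  show "0 < card T0" "card T0 < q" "0 < card T1"
    using q_ge_3 by (simp_all add: t0 t1)
qed (use twisted_fst_nonzero twisted_scale in auto)

text \<open>Now the sizes add up to \<open>q - 1\<close>, so the sum over \<open>twisted\<close> has
  an extra \<open>q\<close> when \<open>1 / b \<in> D0\<close>. By \<open>anti_De\<close> the sum
  over \<open>De\<close> has its extra \<open>q\<close> in the opposite case, so the total no longer
  depends on it.\<close>

lemma type_Q_twisted_Un:
  assumes t0: "card T0 = (q - 1) div 2" and t1: "card T1 = (q - 1) div 2"
    and De: "De = D0 \<or> De = D1" and anti_De: "\<And>x. x \<noteq> 0 \<Longrightarrow> anti * x \<in> De \<longleftrightarrow> x \<notin> D0"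
  shows "type_Q \<psi> q (twisted \<union> {(0, x) | x. x \<in> De})"
proof (rule type_QI)
  let ?E = "twisted \<union> {(0, x) | x. x \<in> De}"
  have c: "of_nat (card T0) = (of_nat q - 1) / (2 :: complex)" "of_nat (card T1) = (of_nat q - 1) / (2 :: complex)"
    unfolding t0 t1 by (rule of_nat_half)+
  have sum_E: "sum f ?E = sum f twisted + (\<Sum>x\<in>De. f (0, x))" for f :: "'a \<times> 'a \<Rightarrow> complex"
  proof -
    have "sum f {(0, x) | x. x \<in> De} = (\<Sum>x\<in>De. f (0, x))"
      by (rule sum.reindex_bij_witness[of _ "\<lambda>x. (0, x)" snd]) auto
    moreover have "sum f ?E = sum f twisted + sum f {(0, x) | x. x \<in> De}"
      using twisted_fst_nonzero by (intro sum.union_disjoint) auto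
    ultimately show ?thesis by simp
  qed
  have card_De: "of_nat (card De) = (of_nat q ^ 2 - 1) / (2 :: complex)"
    using De card_D(1) of_nat_card_D0 by auto
  have "of_nat (card ?E) = (of_nat (card twisted) + of_nat (card De) :: complex)"
    using sum_E[of "\<lambda>_. 1"] by simp
  also have "\<dots> = (of_nat q ^ 4 - 1) / 4"
    unfolding card_twisted card_De c by (simp add: field_simps power2_eq_square power4_eq_xxxx)
  finally show "of_nat (card ?E) = (of_nat q ^ 4 - 1) / (4 :: complex)" .
  have char_E: "char_sum \<psi> a b ?E = char_sum \<psi> a b twisted + (\<Sum>x\<in>De. \<psi> (x * b))" for a b
    unfolding char_sum_def sum_E by (simp add: mult.commute)
  have char_De: "(\<Sum>x\<in>De. \<psi> (x * b)) = of_nat q * of_bool (1 / b \<notin> D0) - (of_nat q + 1) / 2" if b: "b \<noteq> 0" for b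
  proof -
    have "(\<Sum>x\<in>De. \<psi> (x * b)) = of_nat q * of_bool (anti / b \<in> De) - (of_nat q + 1) / 2"
      using De psi_sum_D0[OF b] psi_sum_D1[OF b] by (elim disjE) simp_all
    also have "anti / b \<in> De \<longleftrightarrow> 1 / b \<notin> D0"
      using anti_De[of "1 / b"] b by simp
    finally show ?thesis .
  qed
  \<comment> \<open>Both halves carry the same weight \<open>(q\<^sup>2 - 1) / 4\<close> and their
    character sums add up to \<open>- 1\<close>; adding \<open>card De\<close> always gives
    \<open>(q\<^sup>2 - 1) / 4\<close>.\<close>
  show "char_sum \<psi> a 0 ?E \<in> {(of_nat q ^ 2 - 1) / 4, (- 3 * of_nat q ^ 2 - 1) / 4}" if "a \<noteq> 0" for a
  proof -
    have sum_0: "(\<Sum>x\<in>De. \<psi> (x * 0)) = (of_nat q ^ 2 - 1) / 2"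
      by (simp add: card_De)
    show ?thesis
      unfolding char_E sum_0 char_sum_twisted_0[OF that] c anti_divide_mem_D1[OF that]
      by (cases "anti / a \<in> D0") (simp_all add: field_simps power2_eq_square)
  qed
  show "char_sum \<psi> a b ?E = (of_nat q ^ 2 - 1) / 4 + of_nat q ^ 2 *
      (of_bool (1 / b \<in> D0) * (of_bool (- a / b \<in> S0) + of_bool (- a / b \<in> S1) - 1)
        - of_bool (- a / b \<in> S0) * of_bool (- a / b \<in> S1))" if "b \<noteq> 0" for a b
    unfolding char_E char_sum_twisted[OF that] char_De[OF that] c
    by (cases "1 / b \<in> D0") (simp_all add: field_simps power2_eq_square)
  show "(c * x, c * y) \<in> ?E" if "c \<in> base - {0}" "(x, y) \<in> ?E" for c x y
    using that(2)
  proof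
    assume "(x, y) \<in> twisted"
    then show ?thesis
      by (intro UnI1 twisted_scale that(1))
  next
    assume "(x, y) \<in> {(0, x) | x. x \<in> De}"
    moreover have "cone De"
      using De cone0 cone1 by auto
    ultimately show ?thesis
      using that(1) by (auto simp: cone_def)
  qed
  show "(0, 0) \<notin> ?E"
    using twisted_fst_nonzero De by (auto simp: mem_D1)
  show "0 < card T0" "card T0 < q" "0 < card T1"
    using q_ge_3 by (simp_all add: t0 t1)
qed

end

section \<open>From cyclotomic classes to cones\<close>

theorem theorem3p2:
  fixes \<omega> :: "'a::finite_field"
    and \<zeta> :: complex
    and p s q m l t \<epsilon> :: nat
    and K :: "nat set"
    and T0 T1 S0 S1 A0 A1 D0 D1 :: "'a set"
    and \<psi> :: "'a \<Rightarrow> complex"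
    and E0 E1 :: "('a \<times> 'a) set"
  assumes "prime p" "s \<ge> 1" "q = p ^ s" "odd q"
    and "CARD('a) = q ^ 2"
    and "m \<ge> 1" "2 * m dvd q + 1"
    and "l = (LEAST k. k \<ge> 1 \<and> 2 * m dvd p ^ k + 1)"
    and "s = l * t" "t \<ge> 1"
    and "\<epsilon> = (if even ((p ^ l + 1) div (2 * m)) \<and> odd t then 1 else 0)"
    and "primitive_elem \<omega>"
    and "primitive_root_unity p \<zeta>"
    and "\<psi> = canonical_char \<zeta> p (2 * s)"
    and "K \<subseteq> {0..<2 * m}" "card K = m"
    and "K \<inter> {(x + m) mod (2 * m) | x. x \<in> K} = {}"
    and "D0 = (\<Union>i\<in>K. cyclotomic_class \<omega> (2 * m) i)"
    and "D1 = (\<Union>i\<in>K. cyclotomic_class \<omega> (2 * m) (i + m))"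
    and "T0 \<subseteq> subfield_of_order q" "T1 \<subseteq> subfield_of_order q"
    and "S0 = {x. field_trace q 2 x \<in> T0}"
    and "S1 = {x. field_trace q 2 (x * \<omega> ^ m) \<in> T1}"
    and "A0 = S0 - S1" "A1 = S1 - S0"
    and "E0 = {(x, x * y) | x y. x \<in> D0 \<and> y \<in> A0}
            \<union> {(x, x * y) | x y. x \<in> D1 \<and> y \<in> A1}
            \<union> {(0, x) | x. x \<in> (if \<epsilon> = 0 then D0 else D1)}"
    and "E1 = {(x, x * y) | x y. x \<in> D0 \<and> y \<in> A0}
            \<union> {(x, x * y) | x y. x \<in> D1 \<and> y \<in> A1}"
  shows "(card T0 = (q - 1) div 2 \<and> card T1 = (q - 1) div 2 \<longrightarrow> type_Q \<psi> q E0) \<and>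
         (card T0 = (q - 1) div 2 \<and> card T1 = (q + 1) div 2 \<longrightarrow> type_Q \<psi> q E1)"
proof -
  interpret quadratic_extension p s q \<omega> \<zeta>
    by unfold_locales (fact assms)+
  have m: "m \<ge> 1" and m_dvd: "2 * m dvd q + 1"
    by fact+
  have N: "0 < 2 * m"
    using m by simp
  have N_dvd: "2 * m dvd q\<^sup>2 - 1"
    unfolding q_sq_minus_1 using m_dvd by (rule dvd_mult2)
  have shift: "(r + m) mod (2 * m) \<in> K \<longleftrightarrow> r mod (2 * m) \<notin> K" for r
    using half_residue_system_shift[OF assms(15-17), of "r mod (2 * m)"] m by (simp add: mod_simps)
  have omega_mem_D0: "\<omega> ^ n \<in> D0 \<longleftrightarrow> n mod (2 * m) \<in> K" for n
  proof -
    have "\<omega> ^ n \<in> D0 \<longleftrightarrow> (\<exists>i\<in>K. n mod (2 * m) = i mod (2 * m))"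
      by (simp add: assms(18) omega_power_in_cyclotomic_class[OF N N_dvd] cong_def)
    also have "\<dots> \<longleftrightarrow> (\<exists>i\<in>K. n mod (2 * m) = i)"
      using assms(15) by (intro bex_cong) auto
    finally show ?thesis by simp
  qed
  have omega_mem_D1: "\<omega> ^ n \<in> D1 \<longleftrightarrow> \<omega> ^ n \<notin> D0" for n
  proof -
    have "\<omega> ^ n \<in> D1 \<longleftrightarrow> (\<exists>i\<in>K. [n = i + m] (mod (2 * m)))"
      by (simp add: assms(19) omega_power_in_cyclotomic_class[OF N N_dvd])
    also have "\<dots> \<longleftrightarrow> (\<exists>i\<in>K. (n + m) mod (2 * m) = i)"
    proof (intro bex_cong refl)
      fix i assume "i \<in> K"
      then have i: "i mod (2 * m) = i"
        using assms(15) by auto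
      \<comment> \<open>Adding \<open>m\<close> to both sides turns the shift of \<open>i\<close>
        into a full period, so the shift acts on \<open>n\<close> instead.\<close>
      have "[n = i + m] (mod (2 * m)) \<longleftrightarrow> [n + m = (i + m) + m] (mod (2 * m))"
        by (simp only: cong_add_rcancel_nat)
      also have "\<dots> \<longleftrightarrow> (n + m) mod (2 * m) = (i + 2 * m) mod (2 * m)"
        by (simp only: cong_def add.assoc mult_2)
      also have "(i + 2 * m) mod (2 * m) = i"
        by (simp only: mod_add_self2 i)
      finally show "[n = i + m] (mod (2 * m)) \<longleftrightarrow> (n + m) mod (2 * m) = i" .
    qed
    finally show ?thesis
      by (simp add: omega_mem_D0 shift)
  qed
  have shift_m: "\<omega> ^ m * x \<in> D0 \<longleftrightarrow> x \<notin> D0" if "x \<noteq> 0" for x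
  proof -
    obtain n where n: "x = \<omega> ^ n"
      using \<open>x \<noteq> 0\<close> by (rule omega_log)
    have "\<omega> ^ m * x = \<omega> ^ (n + m)"
      by (simp add: n power_add)
    then show ?thesis
      by (simp only: n omega_mem_D0 shift)
  qed
  have zero_notin: "0 \<notin> D0" "0 \<notin> D1"
    by (auto simp: assms(18,19) cyclotomic_class_def)
  interpret cone_halves p s q \<omega> \<zeta> "\<omega> ^ m" D0 D1 T0 T1 S0 S1
  proof unfold_locales
    have "2 * m \<le> q + 1"
      using m_dvd by (rule dvd_imp_le) simp
    then show "\<omega> ^ m \<notin> base"
      unfolding omega_power_in_base using m by (intro nat_dvd_not_less) auto
    \<comment> \<open>The logarithm of \<open>c\<close> is a multiple of \<open>q + 1\<close>, hence
      of \<open>2 * m\<close>, so multiplication by \<open>c\<close> preserves every class.\<close>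
    have "c * x \<in> D0" if c: "c \<in> base" "c \<noteq> 0" and x: "x \<in> D0" for c x
    proof -
      obtain k where k: "c = \<omega> ^ k"
        using c(2) by (rule omega_log)
      obtain n where n: "x = \<omega> ^ n"
        using x zero_notin by (metis omega_log)
      have "2 * m dvd k"
        using c(1) m_dvd unfolding k omega_power_in_base by (rule dvd_trans[rotated])
      then have "(k + n) mod (2 * m) = n mod (2 * m)"
        by (metis add_0 dvd_imp_mod_0 mod_add_left_eq)
      then show ?thesis
        using x by (simp only: k n omega_mem_D0 flip: power_add)
    qed
    then show "cone D0"
      using zero_notin by (auto simp: cone_def)
    show "D1 = - {0} - D0"
    proof (rule set_eqI)
      fix x
      show "x \<in> D1 \<longleftrightarrow> x \<in> - {0} - D0"
        using zero_notin omega_mem_D1 omega_log[of x] by (cases "x = 0") auto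
    qed
    show "\<omega> ^ m * x \<in> D0 \<longleftrightarrow> x \<notin> D0" if "x \<noteq> 0" for x
      using that by (rule shift_m)
    show "T0 \<subseteq> base" "T1 \<subseteq> base"
      by fact+
    show "S0 = {x. Tr x \<in> T0}"
      by fact
    show "S1 = {x. Tr (x * \<omega> ^ m) \<in> T1}"
      by fact
  qed

  \<comment> \<open>The least exponent exists because \<open>s\<close> itself qualifies.\<close>
  have "l \<ge> 1 \<and> 2 * m dvd p ^ l + 1"
    unfolding assms(8)
    by (rule LeastI[where P = "\<lambda>k. k \<ge> 1 \<and> 2 * m dvd p ^ k + 1" and k = s]) (use s m_dvd in \<open>simp flip: q\<close>)
  moreover have "odd p"
    using odd_q q s by simp
  moreover have q_eq: "q = (p ^ l) ^ t"
    by (simp only: q assms(9) power_mult)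
  ultimately have parity: "even ((q + 1) div (2 * m)) \<longleftrightarrow> \<epsilon> = 1"
    using even_power_plus_1_div[of "p ^ l" m t] m m_dvd \<open>t \<ge> 1\<close>
    by (simp add: assms(11) q_eq[symmetric] del: One_nat_def)
  have eps: "\<epsilon> = 0 \<or> \<epsilon> = 1"
    by (simp add: assms(11))
  define De where "De = (if \<epsilon> = 0 then D0 else D1)"
  \<comment> \<open>The logarithm of \<open>anti\<close> is \<open>m * c\<close> with
    \<open>c = (q + 1) div (2 * m)\<close>. Multiplication by \<open>anti\<close> therefore
    preserves \<open>D0\<close> for even \<open>c\<close> and exchanges the halves for odd
    \<open>c\<close>; the choice made by \<open>\<epsilon>\<close> gives the same equivalence in
    both cases.\<close>
  have anti_De: "anti * x \<in> De \<longleftrightarrow> x \<notin> D0" if "x \<noteq> 0" for x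
  proof -
    obtain c where c: "q + 1 = 2 * m * c"
      using m_dvd by blast
    then have half: "(q + 1) div 2 = m * c"
      by simp
    have c_eq: "(q + 1) div (2 * m) = c"
      unfolding c using m by simp
    obtain n where n: "x = \<omega> ^ n"
      using \<open>x \<noteq> 0\<close> by (rule omega_log)
    have anti_x: "anti * \<omega> ^ n = \<omega> ^ (m * c + n)"
      by (simp only: anti_def half power_add)
    show ?thesis
    proof (cases "even c")
      case True
      then obtain d where "c = 2 * d" by blast
      then have "(m * c + n) mod (2 * m) = (n + 2 * m * d) mod (2 * m)"
        by (simp add: ac_simps)
      then have "(m * c + n) mod (2 * m) = n mod (2 * m)"
        by (simp only: mod_mult_self2)
      moreover have "De = D1"
        using True parity c_eq by (simp add: De_def)
      ultimately show ?thesis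
        by (simp only: anti_x omega_mem_D1 omega_mem_D0 n)
    next
      case False
      then obtain d where "c = 2 * d + 1" by (elim oddE)
      then have "(m * c + n) mod (2 * m) = (n + m + 2 * m * d) mod (2 * m)"
        by (simp add: algebra_simps)
      then have "(m * c + n) mod (2 * m) = (n + m) mod (2 * m)"
        by (simp only: mod_mult_self2)
      moreover have "De = D0"
        using False parity c_eq eps by (auto simp: De_def)
      ultimately show ?thesis
        by (simp only: anti_x omega_mem_D0 n shift)
    qed
  qed
  have A: "A0 = S0 - S1" "A1 = S1 - S0"
    by fact+
  have E1: "E1 = twisted"
    unfolding twisted_def assms(27) A ..
  have E0: "E0 = twisted \<union> {(0, x) | x. x \<in> De}"
    unfolding twisted_def assms(26) A De_def ..
  show ?thesis
    unfolding E0 E1 assms(14)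
    using type_Q_twisted type_Q_twisted_Un[of De] anti_De by (auto simp: De_def)
qed

end
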